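(* Let $n\ge1$ and $k\in\{1,2,\dots,\lfloor\frac{n-1}{2}\rfloor\}$. The map $\psi$ (defined in the context) induces a bijection between the set of Motzkin words $w\in\mathcal{M}_n$ (equivalently, Motzkin polyominoes of length $n$) of semiperimeter $\mathrm{sper}(w)=2n-k$ and the set of Motzkin paths of length $n-1$ with exactly $k$ up steps.
   Context: A Motzkin word of length $n\ge 1$ is a word $w=w_1\cdots w_n$ over the positive integers such that $w_1=1$, and $1\le w_k\le w_{k-1}+1$ and $w_{k-1}\ne w_k$ for $k=2,\dots,n$; $\mathcal{M}_n$ is the set of Motzkin words of length $n$. To $w$ one associates the Motzkin polyomino $P(w)$ with $n$ columns, all bottom-justified, whose $i$-th column consists of $w_i$ unit cells. The perimeter of $P(w)$ is the number of (unit) cell borders that do not touch another cell of $P(w)$, and $\mathrm{sper}(w)$ is half of the perimeter. A Motzkin path of length $m$ is a lattice path in the first quadrant from $(0,0)$ to $(m,0)$ made of $m$ steps from $U=(1,1)$ (up step), $D=(1,-1)$, $F=(1,0)$; $\epsilon$ denotes the empty path or word. The map $\psi$ from $\mathcal{M}_n$ to Motzkin paths of length $n-1$ is defined recursively by $$\psi(w)=\begin{cases}\epsilon & \text{if } w=1,\\ F\,\psi(u) & \text{if } w=1(1+u) \text{ with } u\ne\epsilon,\\ U\,\psi(u)\,D\,\psi(v) & \text{if } w=1(1+u)v \text{ with } u,v\neq\epsilon,\end{cases}$$ where $u,v$ are Motzkin words and $(1+u)$ is the word obtained from $u$ by increasing every letter by one. *)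

theory Defs
  imports Complex_Main "HOL-Library.Product_Plus"
begin

definition motzkin_word :: "nat list \<Rightarrow> bool" where
  "motzkin_word w \<longleftrightarrow> w \<noteq> [] \<and> w ! 0 = 1 \<and>
     (\<forall>k. 1 \<le> k \<and> k < length w \<longrightarrow>
        1 \<le> w ! k \<and> w ! k \<le> w ! (k - 1) + 1 \<and> w ! (k - 1) \<noteq> w ! k)"

definition motzkin_words :: "nat \<Rightarrow> nat list set" where
  "motzkin_words n = {w. motzkin_word w \<and> length w = n}"

text \<open>The unit cell \<open>[x, x+1] \<times> [y, y+1]\<close> is represented by its lower left corner \<open>(x, y)\<close>.\<close>

definition polyomino :: "nat list \<Rightarrow> (nat \<times> nat) set" where
  "polyomino w = {(i, j). i < length w \<and> j < w ! i}"

text \<open>\<open>Hor x y\<close> is the unit segment from \<open>(x, y)\<close> to \<open>(x+1, y)\<close>, and \<open>Ver x y\<close> the one from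
  \<open>(x, y)\<close> to \<open>(x, y+1)\<close>.\<close>

datatype segment = Hor nat nat | Ver nat nat

fun borders :: "nat \<times> nat \<Rightarrow> segment set" where
  "borders (x, y) = {Hor x y, Hor x (y + 1), Ver x y, Ver (x + 1) y}"

definition perimeter :: "(nat \<times> nat) set \<Rightarrow> nat" where
  "perimeter P =
     card {e. \<exists>c\<in>P. e \<in> borders c \<and> \<not> (\<exists>c'\<in>P. c' \<noteq> c \<and> e \<in> borders c')}"

definition sper :: "nat list \<Rightarrow> real" where
  "sper w = real (perimeter (polyomino w)) / 2"

datatype step = Up | Down | Flat

fun step_vec :: "step \<Rightarrow> int \<times> int" where
  "step_vec Up = (1, 1)"
| "step_vec Down = (1, -1)"
| "step_vec Flat = (1, 0)"

definition endpoint :: "step list \<Rightarrow> int \<times> int" where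
  "endpoint p = sum_list (map step_vec p)"

definition motzkin_paths :: "nat \<Rightarrow> step list set" where
  "motzkin_paths m = {p. length p = m \<and> endpoint p = (int m, 0) \<and>
     (\<forall>i\<le>m. 0 \<le> fst (endpoint (take i p)) \<and> 0 \<le> snd (endpoint (take i p)))}"

text \<open>In a word \<open>1(1+u)\<close> or \<open>1(1+u)v\<close>, the block \<open>1+u\<close> is the longest factor after the initial
  letter in which all letters exceed 1, because \<open>v\<close> begins with 1.  This makes the recursion
  explicit.  The values outside Motzkin words are irrelevant; the lemmas \<open>psi_one\<close>, \<open>psi_flat\<close>,
  \<open>psi_up\<close> and \<open>motzkin_word_cases\<close> below give the defining recursion on Motzkin words and show
  that its three cases are exhaustive.\<close>

function psi :: "nat list \<Rightarrow> step list" where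
  "psi [] = []"
| "psi (x # xs) =
     (let u = map (\<lambda>l. l - 1) (takeWhile (\<lambda>l. 1 < l) xs);
          v = dropWhile (\<lambda>l. 1 < l) xs
      in if xs = [] then []
         else if v = [] then Flat # psi u
         else Up # psi u @ Down # psi v)"
  by pat_completeness auto
termination
  by (relation "measure length")
     (auto simp: less_Suc_eq_le length_takeWhile_le length_dropWhile_le)

lemma motzkin_word_ge_1: "motzkin_word w \<Longrightarrow> l \<in> set w \<Longrightarrow> 1 \<le> l"
  unfolding motzkin_word_def in_set_conv_nth by (metis One_nat_def Suc_leI le_numeral_extra(4) neq0_conv)

lemma motzkin_word_hd: "motzkin_word w \<Longrightarrow> w \<noteq> [] \<and> hd w = 1"
  by (auto simp: motzkin_word_def hd_conv_nth)

lemma psi_one: "psi [1] = []"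
  by simp

lemma psi_flat:
  assumes "motzkin_word u"
  shows "psi (1 # map (\<lambda>l. 1 + l) u) = Flat # psi u"
proof -
  let ?s = "map (\<lambda>l. 1 + l) u"
  have gt: "\<forall>l\<in>set ?s. 1 < l"
    using motzkin_word_ge_1[OF assms] by fastforce
  have t: "takeWhile (\<lambda>l. 1 < l) ?s = ?s" and d: "dropWhile (\<lambda>l. 1 < l) ?s = []"
    using gt by (simp_all only: takeWhile_eq_all_conv dropWhile_eq_Nil_conv)
  have "u \<noteq> []" using motzkin_word_hd[OF assms] by simp
  then show ?thesis
    unfolding psi.simps t d Let_def by (simp add: comp_def)
qed

lemma psi_up:
  assumes "motzkin_word u" "motzkin_word v"
  shows "psi (1 # map (\<lambda>l. 1 + l) u @ v) = Up # psi u @ Down # psi v"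
proof -
  let ?s = "map (\<lambda>l. 1 + l) u"
  have gt: "\<And>l. l \<in> set ?s \<Longrightarrow> 1 < l"
    using motzkin_word_ge_1[OF assms(1)] by fastforce
  obtain v' where v: "v = 1 # v'"
    using motzkin_word_hd[OF assms(2)] by (cases v) auto
  have t: "takeWhile (\<lambda>l. 1 < l) (?s @ v) = ?s"
    using gt by (subst takeWhile_append2) (auto simp: v)
  have d: "dropWhile (\<lambda>l. 1 < l) (?s @ v) = v"
    using gt by (subst dropWhile_append2) (auto simp: v)
  show ?thesis
    unfolding psi.simps t d Let_def by (simp add: comp_def v del: psi.simps)
qed

lemma motzkin_word_Cons:
  "motzkin_word (a # xs) \<longleftrightarrow>
     a = 1 \<and> successively (\<lambda>x y. 1 \<le> y \<and> y \<le> x + 1 \<and> x \<noteq> y) (a # xs)"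
proof -
  have "(\<forall>k. 1 \<le> k \<and> k < length (a # xs) \<longrightarrow> Q ((a # xs) ! (k - 1)) ((a # xs) ! k)) \<longleftrightarrow>
        (\<forall>i. Suc i < length (a # xs) \<longrightarrow> Q ((a # xs) ! i) ((a # xs) ! Suc i))" for Q
    by (metis Suc_le_D Suc_le_mono One_nat_def diff_Suc_1 le0)
  from this[of "\<lambda>x y. 1 \<le> y \<and> y \<le> x + 1 \<and> x \<noteq> y"] show ?thesis
    unfolding motzkin_word_def successively_conv_nth by auto
qed

lemma successively_shift:
  assumes "\<forall>l\<in>set xs. 1 < l" "successively (\<lambda>x y. 1 \<le> y \<and> y \<le> x + 1 \<and> x \<noteq> y) xs"
  shows "successively (\<lambda>x y. 1 \<le> y \<and> y \<le> x + 1 \<and> x \<noteq> y) (map (\<lambda>l. l - (1::nat)) xs)"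
  unfolding successively_map
  by (rule successively_mono[OF assms(2)]) (use assms(1) in force)

lemma motzkin_word_cases:
  assumes "motzkin_word w"
  obtains (one) "w = [1]"
  | (flat) u where "motzkin_word u" "w = 1 # map (\<lambda>l. 1 + l) u"
  | (up) u v where "motzkin_word u" "motzkin_word v" "w = 1 # map (\<lambda>l. 1 + l) u @ v"
proof -
  let ?R = "\<lambda>x y :: nat. 1 \<le> y \<and> y \<le> x + 1 \<and> x \<noteq> y"
  obtain xs where w: "w = 1 # xs"
    using motzkin_word_hd[OF assms] by (cases w) auto
  define s where "s = takeWhile (\<lambda>l. 1 < l) xs"
  define v where "v = dropWhile (\<lambda>l. 1 < l) xs"
  define u where "u = map (\<lambda>l. l - 1) s"
  have xs: "xs = s @ v" by (simp add: s_def v_def)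
  have succ: "successively ?R (1 # xs)"
    using assms unfolding w motzkin_word_Cons by simp
  show thesis
  proof (cases "xs = []")
    case True
    then show ?thesis using one w by simp
  next
    case False
    have h: "hd xs = 2"
    proof -
      have "?R 1 (hd xs)" using succ False by (cases xs) auto
      then show ?thesis by linarith
    qed
    obtain s' where s': "s = 2 # s'"
      using h False by (cases xs) (auto simp: s_def)
    have gt: "\<forall>l\<in>set s. 1 < l" by (auto simp: s_def dest: set_takeWhileD)
    have ss: "successively ?R s"
      using succ unfolding xs by (auto simp: successively_append_iff successively_Cons)
    have mu: "motzkin_word u"
      using successively_shift[OF gt ss] unfolding u_def s' by (simp add: motzkin_word_Cons)
    have su: "s = map (\<lambda>l. 1 + l) u"
      using gt unfolding u_def by (induction s) auto
    show ?thesis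
    proof (cases "v = []")
      case True
      then show ?thesis using flat[OF mu] w xs su by simp
    next
      case v: False
      then have "\<not> 1 < hd v" unfolding v_def by (rule hd_dropWhile[rotated]) 
      moreover have "hd v \<in> set w" using v w xs by simp
      then have "1 \<le> hd v" using motzkin_word_ge_1[OF assms] by blast
      ultimately obtain v' where v': "v = 1 # v'" using v by (cases v) auto
      have "successively ?R v"
        using succ unfolding xs by (auto simp: successively_append_iff successively_Cons)
      then have "motzkin_word v" unfolding v' motzkin_word_Cons by simp
      then show ?thesis using up[OF mu] w xs su by simp
    qed
  qed
qed

end

theory Submission
  imports Defs
begin

text \<open>The statistic that links the two sides is the number of descents of a word.

  Every letter being positive, the polyomino contributes two horizontal border segments per column,
  and on each vertical line as many border segments as the heights of the two neighbouring columns
  differ. Since the heights start and end at \<open>0\<close>, falls and rises balance, so the semiperimeter is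
  the number of columns plus the total rise. A Motzkin word rises by exactly \<open>1\<close> at its first
  letter and at every later letter that is not a descent; hence \<open>sper w\<close> is twice the length minus
  the number of descents (\<open>sper_motzkin_word\<close>).

  On the other side, in \<open>1(1+u)v\<close> the only descent besides those of \<open>u\<close> and \<open>v\<close> is the one from the
  end of \<open>1+u\<close> to the letter \<open>1\<close> that begins \<open>v\<close>, and in \<open>1(1+u)\<close> there is no new one; so the
  recursion of \<open>psi\<close> creates one up step per descent (\<open>count_Up_psi\<close>). Finally \<open>psi\<close> is a bijection
  for each length because Motzkin paths have the same unambiguous recursive structure as Motzkin
  words: a nonempty path starts with a flat step, or with an up step whose matching down step is the
  first return to the axis.\<close>

section \<open>Descents and the recursive structure of Motzkin words\<close>

fun descents :: "nat list \<Rightarrow> nat" where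
  "descents (x # y # w) = of_bool (y < x) + descents (y # w)"
| "descents w = 0"

lemma descents_append:
  "xs \<noteq> [] \<Longrightarrow> ys \<noteq> [] \<Longrightarrow>
   descents (xs @ ys) = descents xs + of_bool (hd ys < last xs) + descents ys"
proof (induction xs rule: descents.induct)
  case ("2_2" x)
  then show ?case by (cases ys) auto
qed auto

lemma descents_shift: "descents (map (\<lambda>l. 1 + l) w) = descents w"
  by (induction w rule: descents.induct) auto

lemma motzkin_word_one: "motzkin_word [1]"
  by (simp add: motzkin_word_Cons)

lemma motzkin_word_flat:
  assumes "motzkin_word u"
  shows "motzkin_word (1 # map (\<lambda>l. 1 + l) u)"
proof -
  obtain u' where u: "u = 1 # u'"
    using motzkin_word_hd[OF assms] by (cases u) auto
  have "successively (\<lambda>x y. 1 \<le> y \<and> y \<le> x + 1 \<and> x \<noteq> y) u"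
    using assms unfolding u motzkin_word_Cons by blast
  then have "successively (\<lambda>x y. 1 \<le> y \<and> y \<le> x + 1 \<and> x \<noteq> y) (map (\<lambda>l. 1 + l) u)"
    unfolding successively_map by (rule successively_mono) auto
  then show ?thesis
    unfolding motzkin_word_Cons by (simp add: successively_Cons u del: One_nat_def)
qed

lemma motzkin_word_up:
  assumes "motzkin_word u" "motzkin_word v"
  shows "motzkin_word (1 # map (\<lambda>l. 1 + l) u @ v)"
proof -
  obtain v' where v: "v = 1 # v'"
    using motzkin_word_hd[OF assms(2)] by (cases v) auto
  have u: "u \<noteq> []" using motzkin_word_hd[OF assms(1)] by simp
  then have "1 \<le> last u" using motzkin_word_ge_1[OF assms(1)] by simp
  then have "successively (\<lambda>x y. 1 \<le> y \<and> y \<le> x + 1 \<and> x \<noteq> y) ((1 # map (\<lambda>l. 1 + l) u) @ v)"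
    using motzkin_word_flat[OF assms(1)] assms(2) u
    unfolding v motzkin_word_Cons successively_append_iff by (simp add: last_map)
  then show ?thesis unfolding motzkin_word_Cons append_Cons by blast
qed

lemma motzkin_word_induct [consumes 1, case_names one flat up]:
  assumes "motzkin_word w"
    and "P [1]"
    and "\<And>u. motzkin_word u \<Longrightarrow> P u \<Longrightarrow> P (1 # map (\<lambda>l. 1 + l) u)"
    and "\<And>u v. motzkin_word u \<Longrightarrow> motzkin_word v \<Longrightarrow> P u \<Longrightarrow> P v \<Longrightarrow>
           P (1 # map (\<lambda>l. 1 + l) u @ v)"
  shows "P w"
  using assms(1)
proof (induction w rule: length_induct)
  case (1 w)
  from 1(2) show ?case
    by (cases rule: motzkin_word_cases) (use 1(1) assms(2-) in auto)
qed

section \<open>The semiperimeter\<close>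

text \<open>Truncated subtraction discards the falls; \<open>a\<close> is the height before the first column.\<close>

fun rise :: "nat \<Rightarrow> nat list \<Rightarrow> nat" where
  "rise a [] = 0"
| "rise a (x # w) = (x - a) + rise x w"

text \<open>Heights that start at \<open>a\<close> and end at \<open>0\<close> fall by \<open>a\<close> more than they rise. The two lists hold the
  heights to the left and to the right of each vertical line.\<close>

lemma sum_height_differences:
  "(\<Sum>x\<le>length w. ((w @ [0]) ! x - (a # w) ! x) + ((a # w) ! x - (w @ [0]) ! x)) = a + 2 * rise a w"
proof (induction w arbitrary: a)
  case (Cons b w)
  show ?case
    using Cons.IH[of b] by (simp add: sum.atMost_Suc_shift del: sum.atMost_Suc)
qed simp

text \<open>A segment bounds one cell if it lies on an axis and two cells otherwise; it is a border segment
  of \<open>P\<close> if exactly one of them belongs to \<open>P\<close>.\<close>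

definition border_segments :: "(nat \<times> nat) set \<Rightarrow> segment set" where
  "border_segments P = {e. \<exists>c\<in>P. e \<in> borders c \<and> \<not> (\<exists>c'\<in>P. c' \<noteq> c \<and> e \<in> borders c')}"

lemma border_one_cell:
  assumes "\<And>c. e \<in> borders c \<longleftrightarrow> c = a"
  shows "e \<in> border_segments P \<longleftrightarrow> a \<in> P"
  unfolding border_segments_def mem_Collect_eq assms by auto

lemma border_two_cells:
  assumes "\<And>c. e \<in> borders c \<longleftrightarrow> c = a \<or> c = b" and "a \<noteq> b"
  shows "e \<in> border_segments P \<longleftrightarrow> (a \<in> P) \<noteq> (b \<in> P)"
  unfolding border_segments_def mem_Collect_eq assms(1)
  by (cases "a \<in> P"; cases "b \<in> P") (use assms(2) in auto)

lemma border_segments_simps: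
  "Hor x 0 \<in> border_segments P \<longleftrightarrow> (x, 0) \<in> P"
  "Hor x (Suc y) \<in> border_segments P \<longleftrightarrow> ((x, y) \<in> P) \<noteq> ((x, Suc y) \<in> P)"
  "Ver 0 y \<in> border_segments P \<longleftrightarrow> (0, y) \<in> P"
  "Ver (Suc x) y \<in> border_segments P \<longleftrightarrow> ((x, y) \<in> P) \<noteq> ((Suc x, y) \<in> P)"
proof -
  have "Hor x 0 \<in> borders c \<longleftrightarrow> c = (x, 0)"
    "Hor x (Suc y) \<in> borders c \<longleftrightarrow> c = (x, y) \<or> c = (x, Suc y)"
    "Ver 0 y \<in> borders c \<longleftrightarrow> c = (0, y)"
    "Ver (Suc x) y \<in> borders c \<longleftrightarrow> c = (x, y) \<or> c = (Suc x, y)" for c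
    by (cases c; force)+
  note cells = this
  show "Hor x 0 \<in> border_segments P \<longleftrightarrow> (x, 0) \<in> P"
    by (rule border_one_cell[OF cells(1)])
  show "Hor x (Suc y) \<in> border_segments P \<longleftrightarrow> ((x, y) \<in> P) \<noteq> ((x, Suc y) \<in> P)"
    by (rule border_two_cells[OF cells(2)]) simp
  show "Ver 0 y \<in> border_segments P \<longleftrightarrow> (0, y) \<in> P"
    by (rule border_one_cell[OF cells(3)])
  show "Ver (Suc x) y \<in> border_segments P \<longleftrightarrow> ((x, y) \<in> P) \<noteq> ((Suc x, y) \<in> P)"
    by (rule border_two_cells[OF cells(4)]) simp
qed

text \<open>\<open>Ver x y\<close> is a border exactly if \<open>y\<close> lies between the heights of the columns on its two
  sides, where the empty columns at both ends have height \<open>0\<close>. The union of the two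
  intervals covers both orders of the heights, one of the intervals being empty.\<close>

lemma border_segments_polyomino:
  assumes pos: "\<forall>l\<in>set w. 1 \<le> l"
  shows "border_segments (polyomino w) =
      (\<lambda>x. Hor x 0) ` {..<length w} \<union> (\<lambda>x. Hor x (w ! x)) ` {..<length w} \<union>
      (\<Union>x\<le>length w. Ver x ` ({(0 # w) ! x..<(w @ [0]) ! x} \<union> {(w @ [0]) ! x..<(0 # w) ! x}))"
    (is "_ = ?B")
proof (rule set_eqI)
  have wpos: "0 < w ! i" if "i < length w" for i
    using pos that by (metis nth_mem less_le_trans zero_less_one)
  fix e
  have hor: "Hor x y \<in> ?B \<longleftrightarrow> x < length w \<and> (y = 0 \<or> y = w ! x)" for x y
    by auto
  have ver: "Ver x y \<in> ?B \<longleftrightarrow> x \<le> length w \<and> (y < (0 # w) ! x) \<noteq> (y < (w @ [0]) ! x)" for x y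
    unfolding Un_iff UN_iff by (simp add: image_iff Bex_def) linarith
  show "e \<in> border_segments (polyomino w) \<longleftrightarrow> e \<in> ?B"
  proof (cases e)
    case (Hor x y)
    show ?thesis
      unfolding Hor hor using wpos[of x]
      by (cases y) (auto simp: border_segments_simps polyomino_def)
  next
    case (Ver x y)
    show ?thesis
    proof (cases x)
      case 0
      then show ?thesis
        unfolding Ver ver by (cases w) (simp_all add: border_segments_simps polyomino_def)
    next
      case (Suc m)
      show ?thesis
        unfolding Ver ver Suc
        by (cases "Suc m < length w"; cases "m < length w")
          (auto simp: border_segments_simps polyomino_def nth_append)
    qed
  qed
qed

lemma perimeter_polyomino:
  assumes pos: "\<forall>l\<in>set w. 1 \<le> l"
  shows "perimeter (polyomino w) = 2 * length w + 2 * rise 0 w"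
proof -
  let ?H0 = "(\<lambda>x. Hor x 0) ` {..<length w}" and ?H1 = "(\<lambda>x. Hor x (w ! x)) ` {..<length w}"
  let ?L = "(!) (0 # w)" and ?R = "(!) (w @ [0])"
  let ?V = "\<lambda>x. Ver x ` ({?L x..<?R x} \<union> {?R x..<?L x})"
  have wpos: "0 < w ! i" if "i < length w" for i
    using pos that by (metis nth_mem less_le_trans zero_less_one)
  have "card (?V x) = (?R x - ?L x) + (?L x - ?R x)" for x
    by (subst card_image) (auto simp: inj_on_def card_Un_disjoint)
  then have V: "card (\<Union>x\<le>length w. ?V x) = 2 * rise 0 w"
    using sum_height_differences[of w 0]
    by (subst card_UN_disjoint) auto
  have "card ?H0 = length w" "card ?H1 = length w"
    by (auto simp: card_image inj_on_def)
  \<comment> \<open>Only columns of positive height have a top border different from the bottom one.\<close>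
  moreover have "?H0 \<inter> ?H1 = {}" using wpos by force
  ultimately have H: "card (?H0 \<union> ?H1) = 2 * length w"
    by (simp add: card_Un_disjoint)
  have "card (?H0 \<union> ?H1 \<union> (\<Union>x\<le>length w. ?V x)) = 2 * length w + 2 * rise 0 w"
    using H V by (subst card_Un_disjoint) auto
  then show ?thesis
    unfolding perimeter_def border_segments_def[symmetric] border_segments_polyomino[OF pos] .
qed

text \<open>Consecutive letters differ and never rise by more than \<open>1\<close>, so every step that is not a
  descent contributes exactly \<open>1\<close> to the rise.\<close>

lemma rise_plus_descents:
  "successively (\<lambda>x y. 1 \<le> y \<and> y \<le> x + 1 \<and> x \<noteq> y) (a # w) \<Longrightarrow>
   rise a w + descents (a # w) = length w"
proof (induction w arbitrary: a)
  case (Cons b w)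
  then have IH: "rise b w + descents (b # w) = length w" by auto
  have "b < a \<or> b = a + 1" using Cons.prems by auto
  with IH show ?case by auto
qed simp

lemma sper_motzkin_word:
  assumes "motzkin_word w"
  shows "sper w = 2 * real (length w) - real (descents w)"
proof -
  obtain w' where w: "w = 1 # w'"
    using motzkin_word_hd[OF assms] by (cases w) auto
  have "successively (\<lambda>x y. 1 \<le> y \<and> y \<le> x + 1 \<and> x \<noteq> y) (1 # w')"
    using assms unfolding w motzkin_word_Cons by blast
  from rise_plus_descents[OF this] have "rise 0 w + descents w = length w"
    by (simp add: w)
  moreover have "perimeter (polyomino w) = 2 * length w + 2 * rise 0 w"
    using motzkin_word_ge_1[OF assms] by (intro perimeter_polyomino) blast
  ultimately show ?thesis
    unfolding sper_def by (simp flip: of_nat_add)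
qed

section \<open>Motzkin paths\<close>

fun slope :: "step \<Rightarrow> int" where
  "slope Up = 1"
| "slope Down = -1"
| "slope Flat = 0"

definition height :: "step list \<Rightarrow> int" where
  "height p = sum_list (map slope p)"

lemma height_simps [simp]:
  "height [] = 0" "height (s # p) = slope s + height p" "height (p @ q) = height p + height q"
  by (simp_all add: height_def)

text \<open>The starting height \<open>h\<close> is a parameter so that the condition of staying above the axis can be
  followed step by step and through concatenations.\<close>

fun nonneg_from :: "int \<Rightarrow> step list \<Rightarrow> bool" where
  "nonneg_from h [] \<longleftrightarrow> 0 \<le> h"
| "nonneg_from h (s # p) \<longleftrightarrow> 0 \<le> h \<and> nonneg_from (h + slope s) p"

definition motzkin_path :: "step list \<Rightarrow> bool" where
  "motzkin_path p \<longleftrightarrow> height p = 0 \<and> nonneg_from 0 p"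

lemma nonneg_from_start: "nonneg_from h p \<Longrightarrow> 0 \<le> h"
  by (cases p) auto

lemma nonneg_from_append:
  "nonneg_from h (p @ q) \<longleftrightarrow> nonneg_from h p \<and> nonneg_from (h + height p) q"
  by (induction p arbitrary: h) (auto simp: add.assoc dest: nonneg_from_start)

lemma nonneg_from_mono: "nonneg_from h p \<Longrightarrow> h \<le> h' \<Longrightarrow> nonneg_from h' p"
  by (induction p arbitrary: h h') fastforce+

lemma nonneg_from_iff_take:
  "nonneg_from h p \<longleftrightarrow> (\<forall>i\<le>length p. 0 \<le> h + height (take i p))"
proof (induction p arbitrary: h)
  case (Cons s p)
  have "(\<forall>i\<le>length (s # p). 0 \<le> h + height (take i (s # p))) \<longleftrightarrow>
        0 \<le> h \<and> (\<forall>i\<le>length p. 0 \<le> h + height (take (Suc i) (s # p)))"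
    by (metis Suc_le_mono add_0_right height_simps(1) le0 length_Cons not0_implies_Suc take_0)
  then show ?case
    using Cons[of "h + slope s"] by (simp add: add.assoc)
qed simp

lemma endpoint_eq: "endpoint p = (int (length p), height p)"
proof (induction p)
  case (Cons s p)
  then show ?case by (cases s) (auto simp: endpoint_def)
qed (simp add: endpoint_def zero_prod_def)

lemma motzkin_paths_eq: "motzkin_paths m = {p. length p = m \<and> motzkin_path p}"
  unfolding motzkin_paths_def motzkin_path_def nonneg_from_iff_take
  by (auto simp: endpoint_eq)

lemma motzkin_path_Flat: "motzkin_path (Flat # p) \<longleftrightarrow> motzkin_path p"
  by (simp add: motzkin_path_def)

lemma motzkin_path_up:
  assumes "motzkin_path p" "motzkin_path q"
  shows "motzkin_path (Up # p @ Down # q)"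
  using assms nonneg_from_mono[of 0 p 1]
  by (simp add: motzkin_path_def nonneg_from_append)

text \<open>The distinguished down step is where the path first goes below the axis.\<close>

lemma first_passage:
  "0 \<le> h \<Longrightarrow> h + height p < 0 \<Longrightarrow>
   \<exists>a b. p = a @ Down # b \<and> h + height a = 0 \<and> nonneg_from h a"
proof (induction p arbitrary: h)
  case (Cons s p)
  show ?case
  proof (cases "s = Down \<and> h = 0")
    case True
    then show ?thesis by (intro exI[of _ "[]"] exI[of _ p]) simp
  next
    case False
    then have "0 \<le> h + slope s" using Cons.prems by (cases s) auto
    with Cons.IH[of "h + slope s"] Cons.prems obtain a b
      where "p = a @ Down # b" "h + slope s + height a = 0" "nonneg_from (h + slope s) a"
      by (auto simp: add.assoc)
    then show ?thesis
      using Cons.prems by (intro exI[of _ "s # a"] exI[of _ b]) simp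
  qed
qed simp

text \<open>The counterpart for paths of \<open>motzkin_word_cases\<close>: the part after an initial up step ends at
  height \<open>-1\<close> relative to its start, so it has a first passage to that height.\<close>

lemma motzkin_path_cases:
  assumes "motzkin_path p"
  obtains (empty) "p = []"
  | (flat) q where "motzkin_path q" "p = Flat # q"
  | (up) a b where "motzkin_path a" "motzkin_path b" "p = Up # a @ Down # b"
proof (cases p)
  case Nil
  then show thesis by (rule empty)
next
  case (Cons s q)
  show thesis
  proof (cases s)
    case Flat
    then show thesis using flat assms Cons motzkin_path_Flat by simp
  next
    case Down
    then have False
      using assms Cons by (auto simp: motzkin_path_def dest: nonneg_from_start)
    then show thesis ..
  next
    case Up
    have q: "height q = -1" "nonneg_from 1 q"
      using assms Cons Up by (auto simp: motzkin_path_def)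
    then obtain a b where ab: "q = a @ Down # b" "height a = 0" "nonneg_from 0 a"
      using first_passage[of 0 q] by auto
    then have "motzkin_path a" "motzkin_path b"
      using q by (auto simp: motzkin_path_def nonneg_from_append)
    then show thesis using up Cons Up ab(1) by simp
  qed
qed

text \<open>If the two prefixes had different lengths, the longer one would contain the down step that
  follows the shorter one, and that step leads below the axis.\<close>

lemma first_return_unique:
  assumes "motzkin_path a" "motzkin_path a'" "a @ Down # b = a' @ Down # b'"
  shows "a = a' \<and> b = b'"
proof -
  have no: "\<not> motzkin_path (c @ Down # d)" if "motzkin_path c" for c d
    using that by (auto simp: motzkin_path_def nonneg_from_append dest: nonneg_from_start)
  from assms(3) obtain us where
    "a = a' @ us \<and> us @ Down # b = Down # b' \<or> a @ us = a' \<and> Down # b = us @ Down # b'"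
    unfolding append_eq_append_conv2 by blast
  then show ?thesis
    using no[OF assms(1)] no[OF assms(2)] assms(1,2) by (cases us) auto
qed

section \<open>The bijection\<close>

lemma motzkin_path_psi:
  assumes "motzkin_word w"
  shows "motzkin_path (psi w) \<and> length w = Suc (length (psi w))"
  using assms
proof (induction rule: motzkin_word_induct)
  case one
  show ?case by (simp add: motzkin_path_def)
next
  case (flat u)
  then show ?case unfolding psi_flat[OF flat(1)] by (simp add: motzkin_path_Flat)
next
  case (up u v)
  then show ?case unfolding psi_up[OF up(1,2)] by (simp add: motzkin_path_up)
qed

text \<open>The letter \<open>1\<close> in front of \<open>1+u\<close> is followed by \<open>2\<close>, hence adds no descent; the last letter of
  \<open>1+u\<close> is at least \<open>2\<close>, hence is followed by a descent when \<open>v\<close> begins.\<close>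

lemma count_Up_psi:
  assumes "motzkin_word w"
  shows "count_list (psi w) Up = descents w"
  using assms
proof (induction rule: motzkin_word_induct)
  case one
  show ?case by simp
next
  case (flat u)
  have u: "u \<noteq> []" "hd u = 1" using motzkin_word_hd[OF flat(1)] by auto
  then have "descents (1 # map (\<lambda>l. 1 + l) u) = descents u"
    using descents_append[of "[1]" "map (\<lambda>l. 1 + l) u"] descents_shift[of u] by (simp add: hd_map)
  then show ?case unfolding psi_flat[OF flat(1)] by (simp add: flat)
next
  case (up u v)
  have u: "u \<noteq> []" "hd u = 1" and v: "v \<noteq> []" "hd v = 1"
    using motzkin_word_hd up(1,2) by auto
  have "1 \<le> last u" using motzkin_word_ge_1[OF up(1)] u by simp
  then have "descents (map (\<lambda>l. 1 + l) u @ v) = descents u + 1 + descents v"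
    using descents_append[of "map (\<lambda>l. 1 + l) u" v] descents_shift[of u] u v
    by (simp add: last_map)
  then have "descents (1 # map (\<lambda>l. 1 + l) u @ v) = descents u + 1 + descents v"
    using descents_append[of "[1]" "map (\<lambda>l. 1 + l) u @ v"] u by (simp add: hd_map)
  then show ?case unfolding psi_up[OF up(1,2)] by (simp add: up)
qed

text \<open>Whether the path is empty, and otherwise its first step, tells which case of the recursion
  applies, and the first return to the axis separates the images of \<open>u\<close> and \<open>v\<close>.\<close>

lemma psi_injective:
  assumes "motzkin_word w" "motzkin_word w'" "psi w = psi w'"
  shows "w = w'"
  using assms
proof (induction w arbitrary: w' rule: motzkin_word_induct)
  case one
  from one(1) show ?case
    by (cases rule: motzkin_word_cases) (use one(2) psi_one psi_flat psi_up in \<open>metis list.distinct(1)\<close>)+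
next
  case (flat u)
  from flat.prems(1) show ?case
  proof (cases rule: motzkin_word_cases)
    case (flat u')
    then have "psi u = psi u'"
      using flat.prems(2) \<open>motzkin_word u\<close> psi_flat by (metis list.inject)
    then show ?thesis using flat.IH flat by blast
  next
    case one
    then show ?thesis using flat.prems(2) psi_flat[OF \<open>motzkin_word u\<close>] psi_one by (metis list.distinct(1))
  next
    case (up u' v')
    then show ?thesis
      using flat.prems(2) psi_flat[OF \<open>motzkin_word u\<close>] psi_up[OF up(1,2)] by auto
  qed
next
  case (up u v)
  from up.prems(1) show ?case
  proof (cases rule: motzkin_word_cases)
    case (up u' v')
    then have "psi u @ Down # psi v = psi u' @ Down # psi v'"
      using up.prems(2) \<open>motzkin_word u\<close> \<open>motzkin_word v\<close> psi_up by (metis list.inject)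
    then have "psi u = psi u'" "psi v = psi v'"
      using first_return_unique motzkin_path_psi up(1) \<open>motzkin_word u\<close> by blast+
    then show ?thesis using up.IH up by blast
  next
    case one
    then show ?thesis using up.prems(2) psi_up[OF up.hyps] psi_one by auto
  next
    case (flat u')
    then show ?thesis using up.prems(2) psi_up[OF up.hyps] psi_flat[OF flat(1)] by auto
  qed
qed

lemma psi_surjective:
  assumes "motzkin_path p"
  shows "\<exists>w. motzkin_word w \<and> psi w = p"
  using assms
proof (induction p rule: length_induct)
  case (1 p)
  from 1(2) show ?case
  proof (cases rule: motzkin_path_cases)
    case empty
    then show ?thesis using motzkin_word_one psi_one by blast
  next
    case (flat q)
    then obtain u where "motzkin_word u" "psi u = q" using 1(1) by auto
    then show ?thesis using motzkin_word_flat psi_flat flat(2) by blast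
  next
    case (up a b)
    then obtain u v where "motzkin_word u" "psi u = a" "motzkin_word v" "psi v = b"
      using 1(1)[rule_format, of a] 1(1)[rule_format, of b] by auto
    then show ?thesis using motzkin_word_up psi_up up(3) by blast
  qed
qed

lemma bij_betw_psi:
  assumes "n \<ge> 1"
  shows "bij_betw psi (motzkin_words n) (motzkin_paths (n - 1))"
  unfolding bij_betw_def
proof
  show "inj_on psi (motzkin_words n)"
    by (auto intro: inj_onI psi_injective simp: motzkin_words_def)
  show "psi ` motzkin_words n = motzkin_paths (n - 1)"
  proof
    show "psi ` motzkin_words n \<subseteq> motzkin_paths (n - 1)"
      using motzkin_path_psi by (auto simp: motzkin_words_def motzkin_paths_eq)
    show "motzkin_paths (n - 1) \<subseteq> psi ` motzkin_words n"
    proof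
      fix p assume "p \<in> motzkin_paths (n - 1)"
      then obtain w where "motzkin_word w" "psi w = p" "length p = n - 1"
        using psi_surjective by (auto simp: motzkin_paths_eq)
      with motzkin_path_psi[of w] assms show "p \<in> psi ` motzkin_words n"
        by (auto simp: motzkin_words_def)
    qed
  qed
qed

theorem theorem4p2:
  fixes n k :: nat
  assumes "n \<ge> 1"
    and "k \<in> {1..(n - 1) div 2}"
  shows "bij_betw psi
           {w \<in> motzkin_words n. sper w = 2 * real n - real k}
           {p \<in> motzkin_paths (n - 1). count_list p Up = k}"
proof (rule bij_betw_Collect[OF bij_betw_psi[OF assms(1)]])
  fix w assume "w \<in> motzkin_words n"
  then have "motzkin_word w" "length w = n" by (auto simp: motzkin_words_def)
  then show "count_list (psi w) Up = k \<longleftrightarrow> sper w = 2 * real n - real k"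
    using sper_motzkin_word count_Up_psi by auto
qed

end
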